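(* Let $\lambda$ be a nonzero real number, $r\ge0$ an integer, and $m$ a positive odd integer. Then for every integer $n\ge0$, $$A_{n,\lambda}^{(r)}(x)= m^{n-r}\sum_{l=0}^{m-1}(-1)^{l}A_{n,\lambda/m}^{(r)}\Big(\frac{l+x}{m}\Big).$$
   Context: For nonzero real $\mu$, the generalized falling factorials are $(x)_{0,\mu}=1$, $(x)_{n,\mu}=x(x-\mu)\cdots(x-(n-1)\mu)$ for $n\ge1$; the degenerate exponential is $e_\mu^x(t)=(1+\mu t)^{x/\mu}=\sum_{n\ge0}(x)_{n,\mu}\frac{t^n}{n!}$ and $e_\mu(t)=e_\mu^1(t)$. For an integer $r\ge0$, the generalized degenerate Euler-Genocchi polynomials $A_{n,\mu}^{(r)}(x)$ are defined by $\frac{2t^{r}}{e_{\mu}(t)+1}e_{\mu}^{x}(t)=\sum_{n=0}^{\infty}A_{n,\mu}^{(r)}(x)\frac{t^{n}}{n!}$. *)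

theory Defs
  imports Complex_Main "HOL-Computational_Algebra.Formal_Power_Series"
begin

definition gen_ffact :: "real \<Rightarrow> real \<Rightarrow> nat \<Rightarrow> real" where
  "gen_ffact \<mu> x n = (\<Prod>k<n. x - of_nat k * \<mu>)"

(* The degenerate exponential e_mu^x(t), as a formal power series in t. *)
definition deg_exp :: "real \<Rightarrow> real \<Rightarrow> real fps" where
  "deg_exp \<mu> x = Abs_fps (\<lambda>n. gen_ffact \<mu> x n / fact n)"

(* For mu \<noteq> 0 this series is (1 + mu t)^(x/mu), the binomial series at mu t. *)
lemma deg_exp_eq_binomial:
  assumes "\<mu> \<noteq> 0"
  shows "deg_exp \<mu> x = fps_binomial (x / \<mu>) oo (fps_const \<mu> * fps_X)"
proof (rule fps_ext)
  fix n
  have "(\<Prod>k<n. x - of_nat k * \<mu>) = (\<Prod>k<n. \<mu> * (x / \<mu> - of_nat k))"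
    using assms by (intro prod.cong) (auto simp: field_simps)
  also have "\<dots> = \<mu> ^ n * (\<Prod>k<n. x / \<mu> - of_nat k)"
    by (simp add: prod.distrib)
  finally show "fps_nth (deg_exp \<mu> x) n =
      fps_nth (fps_binomial (x / \<mu>) oo (fps_const \<mu> * fps_X)) n"
    by (simp add: deg_exp_def gen_ffact_def fps_compose_linear gbinomial_prod_rev
        atLeast0LessThan)
qed

definition deg_euler_genocchi_gf :: "nat \<Rightarrow> real \<Rightarrow> real \<Rightarrow> real fps" where
  "deg_euler_genocchi_gf r \<mu> x =
     fps_const 2 * fps_X ^ r / (deg_exp \<mu> 1 + 1) * deg_exp \<mu> x"

definition deg_euler_genocchi :: "nat \<Rightarrow> nat \<Rightarrow> real \<Rightarrow> real \<Rightarrow> real" where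
  "deg_euler_genocchi r n \<mu> x = fact n * fps_nth (deg_euler_genocchi_gf r \<mu> x) n"

(* The division above is by a unit: the denominator has constant term 2. *)
lemma deg_exp_plus_1_unit: "is_unit (deg_exp \<mu> x + 1)"
  by (simp add: fps_is_unit_iff deg_exp_def gen_ffact_def)

end

(* Substituting m t for t turns e_{lam/m}^{y/m} into e_lam^y. Hence the signed sum of the
   generating functions on the right, taken at m t, has numerator proportional to the alternating
   geometric sum of the powers of e_lam; as m is odd, this sum is (e_lam^m + 1) / (e_lam + 1), and
   its numerator cancels the common denominator. The factor m^(n-r) comes from the coefficient
   of t^n and from (m t)^r. *)
theory Submission
  imports Defs
begin

text \<open>The exponent law is inherited from the binomial series, because composition with
  \<open>fps_const \<mu> * fps_X\<close> respects products.\<close>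

lemma deg_exp_add:
  assumes "\<mu> \<noteq> 0"
  shows "deg_exp \<mu> (x + y) = deg_exp \<mu> x * deg_exp \<mu> y"
  using assms
  by (simp add: deg_exp_eq_binomial add_divide_distrib fps_binomial_add_mult
      fps_compose_mult_distrib)

lemma deg_exp_0: "\<mu> \<noteq> 0 \<Longrightarrow> deg_exp \<mu> 0 = 1"
  by (simp add: deg_exp_eq_binomial)

lemma deg_exp_of_nat: "\<mu> \<noteq> 0 \<Longrightarrow> deg_exp \<mu> (of_nat k) = deg_exp \<mu> 1 ^ k"
  by (induction k) (simp_all add: deg_exp_0 deg_exp_add)

text \<open>Falling factorials are homogeneous: each of the \<open>n\<close> factors releases one
  \<open>c\<close>, and the resulting \<open>c ^ n\<close> is what the substitution contributes to
  coefficient \<open>n\<close>.\<close>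

lemma deg_exp_scale:
  assumes "c \<noteq> 0"
  shows "deg_exp (\<mu> / c) (y / c) oo (fps_const c * fps_X) = deg_exp \<mu> y"
proof (rule fps_ext)
  fix n
  have "(\<Prod>k<n. y - of_nat k * \<mu>) = (\<Prod>k<n. c * (y / c - of_nat k * (\<mu> / c)))"
    using assms by (intro prod.cong) (auto simp: field_simps)
  also have "\<dots> = c ^ n * (\<Prod>k<n. y / c - of_nat k * (\<mu> / c))"
    by (simp add: prod.distrib)
  finally show "fps_nth (deg_exp (\<mu> / c) (y / c) oo (fps_const c * fps_X)) n =
      fps_nth (deg_exp \<mu> y) n"
    by (simp add: deg_exp_def gen_ffact_def fps_compose_linear)
qed

text \<open>Clears the denominator, so that the substitution later acts on products and sums only
  and never on a quotient.\<close>

lemma deg_euler_genocchi_gf_mult: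
  "deg_euler_genocchi_gf r \<mu> x * (deg_exp \<mu> 1 + 1) = fps_const 2 * fps_X ^ r * deg_exp \<mu> x"
proof -
  have "(fps_const 2 * fps_X ^ r / (deg_exp \<mu> 1 + 1)) * (deg_exp \<mu> 1 + 1)
      = fps_const 2 * fps_X ^ r"
    by (rule dvd_div_mult_self[OF unit_imp_dvd[OF deg_exp_plus_1_unit]])
  then show ?thesis
    unfolding deg_euler_genocchi_gf_def
    by (subst mult.assoc, subst mult.commute[of "deg_exp \<mu> x"], subst mult.assoc[symmetric])
      (simp only:)
qed

text \<open>This is the geometric sum with ratio \<open>- q\<close>; oddness of \<open>m\<close>
  gives \<open>(- q) ^ m = - (q ^ m)\<close>.\<close>

lemma alternating_geometric_sum_odd:
  fixes q :: "'a :: comm_ring_1"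
  assumes "odd m"
  shows "(q + 1) * (\<Sum>l<m. (-1) ^ l * q ^ l) = q ^ m + 1"
proof -
  have "1 - (- q) ^ m = (1 - (- q)) * (\<Sum>l<m. (- q) ^ l)"
    by (rule one_diff_power_eq)
  then show ?thesis
    using assms by (simp add: power_minus[of q] add.commute[of 1 q] add.commute[of 1 "q ^ m"])
qed

lemma deg_euler_genocchi_gf_multiplication:
  assumes "\<mu> \<noteq> 0" "odd m"
  shows "fps_const (real m ^ r) * deg_euler_genocchi_gf r \<mu> x =
    (\<Sum>l<m. (-1) ^ l * (deg_euler_genocchi_gf r (\<mu> / real m) ((real l + x) / real m)
        oo (fps_const (real m) * fps_X)))"
    (is "?L = (\<Sum>l<m. (-1) ^ l * ?G l)")
proof -
  have m: "real m \<noteq> 0" using assms(2) by (cases m) auto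
  define q where "q = deg_exp \<mu> 1"
  define C where "C = fps_const (2 * real m ^ r) * fps_X ^ r * deg_exp \<mu> x"
  \<comment> \<open>The factor \<open>q ^ m + 1\<close> is the image of the denominator under the
    substitution. It does not depend on \<open>l\<close>; only \<open>q ^ l\<close> does.\<close>
  have G: "?G l * (q ^ m + 1) = C * q ^ l" for l
  proof -
    have "deg_exp (\<mu> / real m) 1 oo (fps_const (real m) * fps_X) = q ^ m"
      using deg_exp_scale[OF m, of \<mu> "real m"] m assms(1) by (simp add: deg_exp_of_nat q_def)
    then have "?G l * (q ^ m + 1) =
        (deg_euler_genocchi_gf r (\<mu> / real m) ((real l + x) / real m) *
          (deg_exp (\<mu> / real m) 1 + 1)) oo (fps_const (real m) * fps_X)"
      by (simp add: fps_compose_mult_distrib fps_compose_add_distrib)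
    also have "\<dots> = fps_const 2 * (fps_const (real m) * fps_X) ^ r * deg_exp \<mu> (real l + x)"
      unfolding deg_euler_genocchi_gf_mult
      by (simp add: fps_compose_mult_distrib fps_compose_power[symmetric] deg_exp_scale[OF m])
    also have "deg_exp \<mu> (real l + x) = q ^ l * deg_exp \<mu> x"
      using assms(1) by (simp add: deg_exp_add deg_exp_of_nat q_def)
    also have "fps_const 2 * (fps_const (real m) * fps_X) ^ r =
        fps_const (2 * real m ^ r) * fps_X ^ r"
      by (simp add: power_mult_distrib fps_const_power flip: fps_const_mult)
    finally show ?thesis by (simp only: C_def mult_ac)
  qed
  \<comment> \<open>Both sides are compared after multiplication by the two denominators
    \<open>q ^ m + 1\<close> and \<open>q + 1\<close>. These are units, hence nonzero, and can be
    cancelled at the end.\<close>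
  have "(\<Sum>l<m. (-1) ^ l * ?G l) * (q ^ m + 1) * (q + 1) =
      (\<Sum>l<m. (-1) ^ l * (?G l * (q ^ m + 1))) * (q + 1)"
    by (simp only: sum_distrib_right mult.assoc)
  also have "(\<Sum>l<m. (-1) ^ l * (?G l * (q ^ m + 1))) = C * (\<Sum>l<m. (-1) ^ l * q ^ l)"
    unfolding G by (simp only: sum_distrib_left mult.left_commute[of _ C])
  also have "\<dots> * (q + 1) = C * ((q + 1) * (\<Sum>l<m. (-1) ^ l * q ^ l))"
    by (simp only: mult_ac)
  also have "\<dots> = C * (q ^ m + 1)"
    by (simp only: alternating_geometric_sum_odd[OF assms(2)])
  also have "\<dots> = fps_const (real m ^ r) *
      (deg_euler_genocchi_gf r \<mu> x * (q + 1)) * (q ^ m + 1)"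
    unfolding q_def C_def deg_euler_genocchi_gf_mult
    by (simp only: fps_const_mult[symmetric] mult_ac)
  finally have "(\<Sum>l<m. (-1) ^ l * ?G l) * ((q ^ m + 1) * (q + 1)) = ?L * ((q ^ m + 1) * (q + 1))"
    by (simp only: mult_ac)
  moreover have "q + 1 \<noteq> 0"
    using deg_exp_plus_1_unit[of \<mu> 1] unfolding q_def by (metis not_is_unit_0)
  moreover have "q ^ m + 1 \<noteq> 0"
    using deg_exp_plus_1_unit[of \<mu> "real m"] deg_exp_of_nat[OF assms(1), of m]
    unfolding q_def by (metis not_is_unit_0)
  ultimately show ?thesis by simp
qed

theorem theorem2:
  fixes lam x :: real and r m n :: nat
  assumes "lam \<noteq> 0" and "m > 0" and "odd m"
  shows "deg_euler_genocchi r n lam x =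
    real m powi (int n - int r) *
      (\<Sum>l = 0..m - 1. (-1) ^ l * deg_euler_genocchi r n (lam / real m) ((real l + x) / real m))"
proof -
  have range: "{0..m - 1} = {..<m}" using assms(2) by auto
  \<comment> \<open>On the left the sign is a power series, on the right a real number; splitting by
    parity reduces both to \<open>f\<close> or \<open>- f\<close>.\<close>
  have sign: "fps_nth ((-1) ^ l * f) n = (-1) ^ l * fps_nth f n" for l and f :: "real fps"
    by (cases "even l") simp_all
  have "real m ^ r * fps_nth (deg_euler_genocchi_gf r lam x) n =
      fps_nth (fps_const (real m ^ r) * deg_euler_genocchi_gf r lam x) n"
    by simp
  also have "\<dots> = real m ^ n * (\<Sum>l<m. (-1) ^ l *
        fps_nth (deg_euler_genocchi_gf r (lam / real m) ((real l + x) / real m)) n)"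
    unfolding deg_euler_genocchi_gf_multiplication[OF assms(1,3)]
    by (simp add: fps_sum_nth sign fps_compose_linear sum_distrib_left mult.left_commute)
  finally have "real m ^ r * deg_euler_genocchi r n lam x = real m ^ n *
      (\<Sum>l<m. (-1) ^ l * deg_euler_genocchi r n (lam / real m) ((real l + x) / real m))"
    by (simp add: deg_euler_genocchi_def sum_distrib_left mult_ac)
  \<comment> \<open>Dividing by \<open>real m ^ r\<close> yields an integer power, since
    \<open>n\<close> may be smaller than \<open>r\<close>.\<close>
  then show ?thesis
    unfolding range using assms(2) by (simp add: power_int_diff field_simps)
qed

end
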